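(* Let $0<q<1$ and let $a,b,z$ be real numbers with $0<z<b-a<1$. Define \[ f(x)= \frac{(xq)_\infty(xq^{1-a-z})_\infty}{(xq^{1-z})_\infty(xq^{1-b})_\infty}x^{b-a-1},\qquad g(x) = \frac{(xq)_\infty(xq^{a+z})_\infty}{(xq^{a+1+z-b})_\infty(xq^a)_\infty} x^{b-a-1}. \] Then \[ \frac{\Gamma_q(b)\Gamma_q(1-a)\Gamma_q(z)\Gamma_q(b-a-z)}{\Gamma_q(b-a)\Gamma_q(a+z)\Gamma_q(1-a-z)}=-(1-q)^{a+1-b}+\frac{\Gamma_q(1-a)\Gamma_q(b-a-z)}{\Gamma_q(b-a)\Gamma_q(1-z)\Gamma_q(1-b)}\int_{0}^{1}f(x)\,d_qx + \frac{\Gamma_q(b)\Gamma_q(z)}{\Gamma_q(b-a)\Gamma_q(a+1+z-b)\Gamma_q(a)}\int_{0}^{1}g(x)\,d_qx . \]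
   Context: For $0<q<1$ and complex $x$, $(x)_\infty=\prod_{k=0}^{\infty}(1-xq^k)$ and $(x)_n=(x)_\infty/(xq^n)_\infty$. The $q$-gamma function is $\Gamma_q(x)=\frac{(q)_\infty}{(q^x)_\infty}(1-q)^{1-x}$. Jackson's $q$-integral is $\int_0^{c} h(t)\,d_qt = c(1-q)\sum_{n=0}^{\infty} h(cq^n)q^n$.
   Formalization: The formal statement additionally assumes that a and b are not integers; for integer a or b the identity is undefined, since Γ_q(1−a) or Γ_q(b) has a pole, or f or g has a zero denominator at x=1. *)

theory Defs
  imports "HOL-Analysis.Analysis"
begin

definition qpoch_inf :: "real \<Rightarrow> 'a::real_normed_field \<Rightarrow> 'a" where
  "qpoch_inf q x = (\<Prod>k. 1 - x * of_real q ^ k)"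

text \<open>
  At the poles of the q-gamma function (real \<open>x\<close>: the non-positive integers) the denominator
  vanishes, so the value is 0 there; hence \<open>1 / Gamma_q q x\<close> is 0 at the poles, which is the
  value of the entire function \<open>1 / \<Gamma>\<^sub>q\<close>.
\<close>
definition Gamma_q :: "real \<Rightarrow> 'a::{real_normed_field, ln} \<Rightarrow> 'a" where
  "Gamma_q q x =
     qpoch_inf q (of_real q) / qpoch_inf q (of_real q powr x) * of_real (1 - q) powr (1 - x)"

definition jackson_integral :: "real \<Rightarrow> real \<Rightarrow> (real \<Rightarrow> 'a::real_normed_field) \<Rightarrow> 'a" where
  "jackson_integral q c h = of_real (c * (1 - q)) * (\<Sum>n. h (c * q ^ n) * of_real (q ^ n))"

end

theory Submission
  imports Defs
begin

text \<open>
  Write \<open>P s = (q\<^sup>s)\<^sub>\<infinity>\<close>. After division by \<open>(1 - q) powr (a + 1 - b)\<close> the left-hand side is the product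
  side of Ramanujan's summation of \<open>\<^sub>1\<psi>\<^sub>1(q\<^sup>a; q\<^sup>b; q\<^sup>z)\<close>. The halves of the bilateral series over \<open>n \<ge> 0\<close> and
  \<open>n \<le> 0\<close> are interchanged by \<open>(a, b, z) \<mapsto> (1 - b, 1 - a, b - a - z)\<close>, and Heine's transformation
  turns them into the q-integrals of \<open>g\<close> and \<open>f\<close>; the term \<open>n = 0\<close> is counted twice, whence the
  summand \<open>-1\<close>.

  Each summation is proved by a contiguous relation that shifts one parameter by 1; iterating it sends
  that parameter to infinity, where the series degenerates. Ramanujan's sum in particular depends
  on \<open>b\<close> only through an explicit factor, so it may be evaluated at \<open>b = 1\<close>, where it is the q-binomial
  series.
\<close>

section \<open>Limits under the sum and index shifts of bilateral series\<close>

lemma suminf_dominated_convergence: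
  fixes f :: "nat \<Rightarrow> nat \<Rightarrow> real"
  assumes "\<And>k. (\<lambda>N. f N k) \<longlonglongrightarrow> g k" and "\<And>N k. \<bar>f N k\<bar> \<le> M k" and "summable M"
  shows "(\<lambda>N. \<Sum>k. f N k) \<longlonglongrightarrow> (\<Sum>k. g k)"
  using tannerys_theorem[of "\<lambda>k N. f N k" g sequentially M] assms
  by (auto simp: case_prod_unfold)

text \<open>A bilateral series is kept as two halves, over the indices n and -1-n with n >= 0.
  Shifting the index only moves the term \<open>u 0\<close> from the first half to the
  second.\<close>

lemma bilateral_suminf_shift:
  fixes u :: "real \<Rightarrow> real"
  assumes "summable (\<lambda>n. u (real n))" and "summable (\<lambda>n. u (- 1 - real n))"
  shows "summable (\<lambda>n. u (real n + 1))" and "summable (\<lambda>n. u (- 1 - real n + 1))"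
    and "(\<Sum>n. u (real n + 1)) + (\<Sum>n. u (- 1 - real n + 1)) = (\<Sum>n. u (real n)) + (\<Sum>n. u (- 1 - real n))"
proof -
  have e: "u (- 1 - real (Suc n) + 1) = u (- 1 - real n)" for n by simp
  show 1: "summable (\<lambda>n. u (real n + 1))"
    using assms(1) summable_Suc_iff[of "\<lambda>n. u (real n)"] by (simp add: add_ac)
  show 2: "summable (\<lambda>n. u (- 1 - real n + 1))"
    using assms(2) unfolding e[symmetric] by (subst (asm) summable_Suc_iff)
  have "(\<Sum>n. u (real n + 1)) = (\<Sum>n. u (real n)) - u 0"
    using suminf_split_head[OF assms(1)] by (simp add: add_ac)
  moreover have "(\<Sum>n. u (- 1 - real n)) = (\<Sum>n. u (- 1 - real n + 1)) - u 0"
    using suminf_split_head[OF 2] by simp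
  ultimately show "(\<Sum>n. u (real n + 1)) + (\<Sum>n. u (- 1 - real n + 1)) = (\<Sum>n. u (real n)) + (\<Sum>n. u (- 1 - real n))"
    by simp
qed

section \<open>The infinite q-shifted factorial as a function of the exponent\<close>

locale q_base =
  fixes q :: real
  assumes q_pos: "0 < q" and q_less_1: "q < 1"
begin

lemma convergent_prod_qpoch: "convergent_prod (\<lambda>k. 1 - x * q ^ k)"
proof -
  have "summable (\<lambda>k. norm (- x) * norm (q ^ k))"
    using q_pos q_less_1 by (intro summable_mult) (simp add: norm_power)
  then have "summable (\<lambda>k. norm ((1 - x * q ^ k) - 1))"
    by (simp add: abs_mult)
  then show ?thesis
    by (simp only: abs_convergent_prod_conv_summable[symmetric] abs_convergent_prod_imp_convergent_prod)
qed

lemma qpoch_LIMSEQ: "(\<lambda>n. \<Prod>i\<le>n. 1 - x * q ^ i) \<longlonglongrightarrow> qpoch_inf q x"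
  using convergent_prod_LIMSEQ[OF convergent_prod_qpoch] by (simp add: qpoch_inf_def)

lemma qpoch_split: "qpoch_inf q x = (\<Prod>k<n. 1 - x * q ^ k) * qpoch_inf q (x * q ^ n)"
  using has_prod_unique[OF has_prod_ignore_initial_segment'[OF convergent_prod_qpoch[of x], of n]]
  by (simp add: qpoch_inf_def power_add mult_ac)

text \<open>Finite q-shifted factorials are quotients of values of \<open>P\<close>: (q^s)_n is
  \<open>P s / P (s + n)\<close>. Hence (q^a)_n / (q^b)_n appears as
  \<open>P (b + n) / P (a + n)\<close> up to the constant \<open>P a / P b\<close>, and this form
  also makes sense for negative n.\<close>

definition P :: "real \<Rightarrow> real" where
  "P s = qpoch_inf q (q powr s)"

lemma powr_add_nat: "q powr (s + real n) = q powr s * q ^ n"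
  using q_pos by (simp add: powr_add powr_realpow)

lemma P_split: "P s = (\<Prod>k<n. 1 - q powr (s + real k)) * P (s + real n)"
  using qpoch_split[of "q powr s" n] by (simp add: P_def powr_add_nat)

lemma P_rec: "P s = (1 - q powr s) * P (s + 1)"
  using P_split[of s 1] by simp

lemma powr_less_1: "s > 0 \<Longrightarrow> q powr s < 1"
  using q_pos q_less_1 powr_less_mono'[of q 0 s] by simp

lemma P_pos: assumes "s > 0" shows "P s > 0"
proof -
  have "1 - q powr s * q ^ i > 0" for i
    using powr_less_1[of "s + real i"] assms by (simp add: powr_add_nat)
  then show ?thesis
    unfolding P_def qpoch_inf_def using less_0_prodinf[OF convergent_prod_qpoch[of "q powr s"]] by simp
qed

lemma P_nonzero: assumes "s \<notin> \<int>\<^sub>\<le>\<^sub>0" shows "P s \<noteq> 0"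
proof -
  have "1 - q powr s * q ^ i \<noteq> 0" for i
  proof
    assume "1 - q powr s * q ^ i = 0"
    then have "q powr (s + real i) = q powr 0"
      using q_pos by (simp add: powr_add_nat)
    then have "s = - real i"
      using q_pos q_less_1 by (subst (asm) powr_inj) auto
    then show False using assms by simp
  qed
  then show ?thesis
    unfolding P_def qpoch_inf_def using prodinf_nonzero[OF convergent_prod_qpoch[of "q powr s"]] by simp
qed

text \<open>These zeros remove the boundary term of the telescoping sums (\<open>P 0 = 0\<close>)
  and the negative half of the bilateral series at b = 1.\<close>

lemma P_nonpos_nat: "P (- real n) = 0"
  using P_split[of "- real n" "Suc n"] q_pos by simp

lemma P_partial_prod: "(\<lambda>n. \<Prod>k<n. 1 - q powr (s + real k)) \<longlonglongrightarrow> P s"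
  using qpoch_LIMSEQ[of "q powr s"]
  by (subst filterlim_sequentially_Suc[symmetric]) (simp add: P_def lessThan_Suc_atMost powr_add_nat)

text \<open>For s > 0, \<open>P (s + real n)\<close> is the nonzero number \<open>P s\<close>
  divided by a partial product that converges to \<open>P s\<close>. An offset of the index moves
  any other s into this range.\<close>

lemma P_tendsto_1: "(\<lambda>n. P (s + real n)) \<longlonglongrightarrow> 1"
proof -
  have pos: "(\<lambda>n. P (s + real n)) \<longlonglongrightarrow> 1" if "s > 0" for s
  proof -
    let ?p = "\<lambda>n. \<Prod>k<n. 1 - q powr (s + real k)"
    have "(\<lambda>n. P s / ?p n) \<longlonglongrightarrow> P s / P s"
      using P_pos[OF that] by (intro tendsto_intros P_partial_prod) auto
    moreover have "P s / ?p n = P (s + real n)" for n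
    proof -
      have "?p n \<noteq> 0"
      proof
        assume "?p n = 0"
        then have "P s = 0" by (subst P_split[of _ n]) simp
        then show False using P_pos[OF that] by simp
      qed
      then show ?thesis using P_split[of s n] by (metis nonzero_mult_div_cancel_left)
    qed
    ultimately show ?thesis using P_pos[OF that] by simp
  qed
  obtain m where "s + real m > 0"
    by (metis add.commute diff_0 diff_less_eq reals_Archimedean2)
  then have "(\<lambda>n. P (s + real (n + m))) \<longlonglongrightarrow> 1"
    using pos[of "s + real m"] by (simp add: add_ac)
  then show ?thesis by (rule LIMSEQ_offset)
qed

lemma nonint_not_nonpos: "s \<notin> \<int> \<Longrightarrow> s \<notin> \<int>\<^sub>\<le>\<^sub>0" for s :: real
  by (auto elim: nonpos_Ints_cases)

lemma shift_not_nonpos: "s \<notin> \<int>\<^sub>\<le>\<^sub>0 \<Longrightarrow> s + real n \<notin> \<int>\<^sub>\<le>\<^sub>0" for s :: real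
  using nonpos_Ints_diff_Nats[of "s + real n" "real n"] by auto

lemma P_bounded: "\<exists>C>0. \<forall>n. \<bar>P (s + real n)\<bar> \<le> C"
  using convergent_imp_Bseq[OF convergentI[OF P_tendsto_1[of s]]] by (auto simp: Bseq_def)

lemma P_inverse_bounded: assumes "s \<notin> \<int>\<^sub>\<le>\<^sub>0" shows "\<exists>C>0. \<forall>n. \<bar>inverse (P (s + real n))\<bar> \<le> C"
proof -
  have "(\<lambda>n. inverse (P (s + real n))) \<longlonglongrightarrow> inverse 1"
    by (intro tendsto_intros P_tendsto_1) auto
  from convergent_imp_Bseq[OF convergentI[OF this]] show ?thesis by (auto simp: Bseq_def)
qed

lemma abs_mult_power_le:
  assumes "\<bar>u\<bar> \<le> C" shows "\<bar>u * (q powr d) ^ n\<bar> \<le> C * (q powr d) ^ n"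
  using assms by (simp add: abs_mult mult_right_mono)

lemma summable_geometric_powr: "d > 0 \<Longrightarrow> summable (\<lambda>n. C * (q powr d) ^ n)"
  using powr_less_1[of d] by (intro summable_mult summable_geometric) simp

lemma summable_bounded_geometric:
  assumes "d > 0" and "\<And>n. \<bar>u n\<bar> \<le> C"
  shows "summable (\<lambda>n. u n * (q powr d) ^ n)"
  by (rule summable_comparison_test'[OF summable_geometric_powr[OF assms(1), of C], of 0])
     (use abs_mult_power_le[OF assms(2)] in auto)

text \<open>The two indices are independent, so that one of them can be offset by N and the bound
  stays uniform in N, as dominated convergence requires.\<close>

lemma quotient_bounded:
  assumes "a \<notin> \<int>\<^sub>\<le>\<^sub>0"
  obtains C where "\<And>m n. \<bar>P (b + real n) / P (a + real m)\<bar> \<le> C"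
proof -
  obtain C D where C: "C > 0" "\<And>n. \<bar>P (b + real n)\<bar> \<le> C"
    and D: "D > 0" "\<And>m. \<bar>inverse (P (a + real m))\<bar> \<le> D"
    using P_bounded[of b] P_inverse_bounded[OF assms] by blast
  have "\<bar>P (b + real n) / P (a + real m)\<bar> \<le> C * D" for m n
    unfolding divide_inverse abs_mult using C D by (intro mult_mono) auto
  then show ?thesis by (rule that)
qed

lemma quotient2_bounded:
  assumes "a \<notin> \<int>\<^sub>\<le>\<^sub>0" "b \<notin> \<int>\<^sub>\<le>\<^sub>0"
  obtains C where "\<And>k l m n. \<bar>P (c + real k) * P (d + real l) / (P (a + real m) * P (b + real n))\<bar> \<le> C"
proof -
  obtain C where C: "\<And>m n. \<bar>P (c + real n) / P (a + real m)\<bar> \<le> C"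
    using quotient_bounded[OF assms(1), of c] by blast
  obtain D where D: "\<And>m n. \<bar>P (d + real n) / P (b + real m)\<bar> \<le> D"
    using quotient_bounded[OF assms(2), of d] by blast
  have "\<bar>P (c + real k) * P (d + real l) / (P (a + real m) * P (b + real n))\<bar> \<le> C * D" for k l m n
  proof -
    have "C \<ge> 0" using C[of 0 0] by linarith
    then have "\<bar>P (c + real k) / P (a + real m)\<bar> * \<bar>P (d + real l) / P (b + real n)\<bar> \<le> C * D"
      by (intro mult_mono C D) auto
    then show ?thesis by (simp add: abs_mult)
  qed
  then show ?thesis by (rule that)
qed

lemma mult_powr_power_tendsto_0:
  assumes "d > 0" and "\<And>n. \<bar>u n\<bar> \<le> C"
  shows "(\<lambda>n. u n * (q powr d) ^ n) \<longlonglongrightarrow> 0"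
  by (rule summable_LIMSEQ_zero[OF summable_bounded_geometric[OF assms]])

subsection \<open>The q-binomial theorem and the q-Gauss sum\<close>

text \<open>The difference of the two sides is, term by term, the forward difference of the
  certificate \<open>?g\<close>. This telescopes to 0, because \<open>?g\<close> tends to 0 and
  \<open>?g 0\<close> contains \<open>P 0 = 0\<close>.\<close>

lemma binomial_contiguous:
  assumes s: "s \<notin> \<int>\<^sub>\<le>\<^sub>0" and z: "z > 0"
  defines "B \<equiv> \<lambda>z. \<Sum>k. P (1 + real k) / P (s + real k) * (q powr z) ^ k"
  shows "(1 - q powr z) * B z = (1 - q powr (s + z)) * B (z + 1)"
proof -
  let ?t = "\<lambda>z k. P (1 + real k) / P (s + real k) * (q powr z) ^ k"
  let ?g = "\<lambda>k. - (P (0 + real k) / P (s + real k)) * (q powr z) ^ k"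
  obtain C where C: "\<And>m n. \<bar>P (1 + real n) / P (s + real m)\<bar> \<le> C"
    using quotient_bounded[OF s, of 1] by blast
  obtain D where D: "\<And>m n. \<bar>P (0 + real n) / P (s + real m)\<bar> \<le> D"
    using quotient_bounded[OF s, of 0] by blast
  have sums: "?t z sums B z" if "z > 0" for z
    unfolding B_def using summable_bounded_geometric[OF that C] by (rule summable_sums)
  have "(\<lambda>k. ?g (Suc k) - ?g k) sums (0 - ?g 0)"
    by (intro telescope_sums mult_powr_power_tendsto_0[OF z, of _ D]) (use D in simp)
  moreover have "?g (Suc k) - ?g k = (1 - q powr z) * ?t z k - (1 - q powr (s + z)) * ?t (z + 1) k" for k
  proof -
    have nz: "P (s + real k) \<noteq> 0" "P (s + real k + 1) \<noteq> 0"
      using P_nonzero[OF shift_not_nonpos[OF s, of k]] P_nonzero[OF shift_not_nonpos[OF s, of "Suc k"]]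
      by (auto simp: add_ac)
    have r: "P (s + real k) = (1 - q powr s * q ^ k) * P (s + real k + 1)"
      using P_rec[of "s + real k"] by (simp add: powr_add_nat)
    have r0: "P (real k) = (1 - q ^ k) * P (1 + real k)"
      using P_rec[of "real k"] q_pos by (simp add: powr_realpow add_ac)
    have f: "1 - q powr s * q ^ k \<noteq> 0" using nz r by auto
    have "?g (Suc k) = - (P (1 + real k) / P (s + real k + 1)) * (q powr z) ^ k * q powr z"
      by (simp add: add_ac)
    also have "\<dots> = - ((1 - q powr s * q ^ k) * q powr z * ?t z k)"
      using nz f by (simp add: r mult_ac)
    finally have g1: "?g (Suc k) = - ((1 - q powr s * q ^ k) * q powr z * ?t z k)" .
    have g0: "?g k = - ((1 - q ^ k) * ?t z k)"
      by (simp add: r0)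
    have t1: "?t (z + 1) k = q ^ k * ?t z k"
      using q_pos by (simp add: powr_add power_mult_distrib)
    \<comment> \<open>For y = q^k and f = 1 - q^s q^k the quotient (1 - f) / y is q^s, which with x
      = q^z produces the coefficient 1 - q^(s+z).\<close>
    have "- (f * x * T) - - ((1 - y) * T) = (1 - x) * T - (1 - (1 - f) / y * x) * (y * T)"
      if "y \<noteq> 0" for f x y T :: real
      using that by (simp add: field_simps)
    from this[of "q ^ k" "1 - q powr s * q ^ k" "q powr z" "?t z k"] show ?thesis
      unfolding g1 g0 t1 unfolding powr_add using q_pos
      by (simp del: times_divide_eq_left times_divide_eq_right)
  qed
  ultimately have s0: "(\<lambda>k. (1 - q powr z) * ?t z k - (1 - q powr (s + z)) * ?t (z + 1) k) sums 0"
    using P_nonpos_nat[of 0] by simp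
  have s1: "(\<lambda>k. (1 - q powr z) * ?t z k - (1 - q powr (s + z)) * ?t (z + 1) k)
      sums ((1 - q powr z) * B z - (1 - q powr (s + z)) * B (z + 1))"
    using z by (intro sums_diff sums_mult sums) auto
  show ?thesis using sums_unique2[OF s0 s1] by simp
qed

text \<open>Up to the factor \<open>P 1 / P s\<close> this is the sum of (q^s)_k / (q)_k x^k at x =
  q^z. Each step z -> z+1 splits a factor 1 - q^(s+z) off \<open>B z * P z\<close>, so the iteration
  builds up \<open>P (s + z)\<close>.\<close>

theorem q_binomial:
  assumes s: "s \<notin> \<int>\<^sub>\<le>\<^sub>0" and z: "z > 0"
  shows "(\<Sum>k. P (1 + real k) / P (s + real k) * (q powr z) ^ k) = P 1 * P (s + z) / (P s * P z)"
proof -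
  define B where "B = (\<lambda>z. \<Sum>k. P (1 + real k) / P (s + real k) * (q powr z) ^ k)"
  have step: "B z * P z = (1 - q powr (s + z)) * (B (z + 1) * P (z + 1))" if "z > 0" for z
  proof -
    have "(1 - q powr z) * B z = (1 - q powr (s + z)) * B (z + 1)"
      unfolding B_def by (rule binomial_contiguous[OF s that])
    then show ?thesis by (subst P_rec) (simp add: mult_ac)
  qed
  have iter: "B z * P z = (\<Prod>k<N. 1 - q powr (s + z + real k)) * (B (z + real N) * P (z + real N))" for N
  proof (induction N)
    case (Suc N)
    then show ?case using step[of "z + real N"] z by (simp add: add_ac)
  qed simp
  obtain C where C: "\<And>m n. \<bar>P (1 + real n) / P (s + real m)\<bar> \<le> C"
    using quotient_bounded[OF s, of 1] by blast
  \<comment> \<open>Since \<open>0 ^ 0 = 1\<close>, the limit series reduces to its term k = 0,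
    which is \<open>P 1 / P s\<close>.\<close>
  have "(\<lambda>N. B (z + real N)) \<longlonglongrightarrow> (\<Sum>k. P (1 + real k) / P (s + real k) * 0 ^ k)"
    unfolding B_def
  proof (rule suminf_dominated_convergence)
    show "(\<lambda>N. P (1 + real k) / P (s + real k) * (q powr (z + real N)) ^ k)
        \<longlonglongrightarrow> P (1 + real k) / P (s + real k) * 0 ^ k" for k
      unfolding powr_add_nat using q_pos q_less_1
      by (intro tendsto_intros tendsto_mult_right_zero LIMSEQ_power_zero) auto
    show "\<bar>P (1 + real k) / P (s + real k) * (q powr (z + real N)) ^ k\<bar> \<le> C * (q powr z) ^ k" for N k
    proof -
      have "(q powr (z + real N)) ^ k \<le> (q powr z) ^ k"
        using q_pos q_less_1 by (intro power_mono) (auto simp: powr_add_nat mult_left_le power_le_one)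
      moreover have "C \<ge> 0" using C[of 0 0] by linarith
      ultimately show ?thesis unfolding abs_mult[of _ "_ ^ _"] by (intro mult_mono C) auto
    qed
    show "summable (\<lambda>k. C * (q powr z) ^ k)" using z by (rule summable_geometric_powr)
  qed
  then have "(\<lambda>N. (\<Prod>k<N. 1 - q powr (s + z + real k)) * (B (z + real N) * P (z + real N)))
      \<longlonglongrightarrow> P (s + z) * (P 1 / P s * 1)"
    unfolding powser_zero by (intro tendsto_mult P_partial_prod P_tendsto_1) simp
  then have "B z * P z = P (s + z) * (P 1 / P s)"
    unfolding iter[symmetric] by (simp add: LIMSEQ_const_iff)
  then have "B z = P 1 * P (s + z) / (P s * P z)"
    using P_pos[OF z] P_nonzero[OF s] by (simp add: field_simps)
  then show ?thesis unfolding B_def .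
qed

text \<open>\<open>K c\<close> is a multiple of 2phi1(q^a, q^b; q^c; q^(c-a-b)), so the step c ->
  c+1 also changes the argument. As in the q-binomial case the relation telescopes, with a
  certificate that vanishes at 0 because of \<open>P 0\<close>.\<close>

lemma Gauss_contiguous:
  assumes a: "a \<notin> \<int>\<^sub>\<le>\<^sub>0" and b: "b \<notin> \<int>\<^sub>\<le>\<^sub>0" and c: "c - a - b > 0"
  defines "K \<equiv> \<lambda>c. \<Sum>m. P (1 + real m) * P (c + real m) / (P (a + real m) * P (b + real m))
      * (q powr (c - a - b)) ^ m"
  shows "(1 - q powr (c - a - b)) * K c = (1 - q powr (c - a)) * (1 - q powr (c - b)) * K (c + 1)"
proof -
  let ?t = "\<lambda>c m. P (1 + real m) * P (c + real m) / (P (a + real m) * P (b + real m))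
      * (q powr (c - a - b)) ^ m"
  let ?g = "\<lambda>m. - (P (0 + real m) * P (c + real m) / (P (a + real m) * P (b + real m)))
      * (q powr (c - a - b)) ^ m"
  have sums: "?t c sums K c" if "c - a - b > 0" for c
  proof -
    obtain C where "\<And>k l m n. \<bar>P (1 + real k) * P (c + real l) / (P (a + real m) * P (b + real n))\<bar> \<le> C"
      using quotient2_bounded[OF a b, of 1 c] by blast
    from summable_bounded_geometric[OF that this] show ?thesis
      unfolding K_def by (rule summable_sums)
  qed
  obtain D where D: "\<And>k l m n. \<bar>P (0 + real k) * P (c + real l) / (P (a + real m) * P (b + real n))\<bar> \<le> D"
    using quotient2_bounded[OF a b, of 0 c] by blast
  have "(\<lambda>k. ?g (Suc k) - ?g k) sums (0 - ?g 0)"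
    by (intro telescope_sums mult_powr_power_tendsto_0[OF c, of _ D]) (use D in simp)
  moreover have "?g (Suc m) - ?g m = (1 - q powr (c - a - b)) * ?t c m
      - (1 - q powr (c - a)) * (1 - q powr (c - b)) * ?t (c + 1) m" for m
  proof -
    define A B G w y where "A = q powr a" "B = q powr b" "G = q powr c" "w = q powr (c - a - b)" "y = q ^ m"
    have G: "G = w * A * B" "q powr (c - a) = w * B" "q powr (c - b) = w * A"
      by (auto simp: A_B_G_w_y_def powr_add[symmetric])
    define X Y D E where "X = P (1 + real m)" "Y = P (c + real m + 1)"
      "D = P (a + real m + 1)" "E = P (b + real m + 1)"
    have rX: "P (0 + real m) = (1 - y) * X"
      using P_rec[of "real m"] q_pos by (simp add: powr_realpow add_ac X_Y_D_E_def A_B_G_w_y_def)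
    have r: "P (a + real m) = (1 - A * y) * D" "P (b + real m) = (1 - B * y) * E"
        "P (c + real m) = (1 - G * y) * Y"
      using P_rec[of "a + real m"] P_rec[of "b + real m"] P_rec[of "c + real m"]
      by (auto simp: X_Y_D_E_def A_B_G_w_y_def powr_add_nat)
    have nz: "(1 - A * y) * D \<noteq> 0" "(1 - B * y) * E \<noteq> 0"
      using P_nonzero[OF shift_not_nonpos[OF a, of m]] P_nonzero[OF shift_not_nonpos[OF b, of m]]
      unfolding r by auto
    \<comment> \<open>All four quantities \<open>?g (Suc m)\<close>, \<open>?g m\<close>,
      \<open>?t c m\<close>, \<open>?t (c + 1) m\<close> are polynomial multiples of
      \<open>T\<close>, so the claim becomes a polynomial identity in \<open>A\<close>,
      \<open>B\<close>, \<open>w\<close>, \<open>y\<close>.\<close>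
    define T where "T = X * Y / ((1 - A * y) * D * ((1 - B * y) * E)) * w ^ m"
    have "?g (Suc m) = - (X * Y / (D * E)) * w ^ m * w"
      by (simp add: X_Y_D_E_def A_B_G_w_y_def add_ac)
    also have "\<dots> = - (w * (1 - A * y) * (1 - B * y) * T)"
      using nz by (simp add: T_def)
    finally have g1: "?g (Suc m) = - (w * (1 - A * y) * (1 - B * y) * T)" .
    have g0: "?g m = - ((1 - y) * (1 - G * y) * T)"
      unfolding rX r A_B_G_w_y_def(4)[symmetric] by (simp add: T_def mult_ac)
    have t0: "?t c m = (1 - G * y) * T"
      unfolding r X_Y_D_E_def(1)[symmetric] A_B_G_w_y_def(4)[symmetric] by (simp add: T_def)
    have "q powr (c + 1 - a - b) = w * q"
      using powr_add_nat[of "c - a - b" 1] by (simp add: A_B_G_w_y_def algebra_simps)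
    moreover have "P (c + 1 + real m) = Y" by (simp add: X_Y_D_E_def add_ac)
    ultimately have t1: "?t (c + 1) m = y * T"
      unfolding r X_Y_D_E_def(1)[symmetric] by (simp add: T_def A_B_G_w_y_def(5) power_mult_distrib)
    show ?thesis
      unfolding g1 g0 t0 t1 unfolding A_B_G_w_y_def(4)[symmetric] G by algebra
  qed
  ultimately have s0: "(\<lambda>m. (1 - q powr (c - a - b)) * ?t c m
      - (1 - q powr (c - a)) * (1 - q powr (c - b)) * ?t (c + 1) m) sums 0"
    using P_nonpos_nat[of 0] by simp
  have s1: "(\<lambda>m. (1 - q powr (c - a - b)) * ?t c m
      - (1 - q powr (c - a)) * (1 - q powr (c - b)) * ?t (c + 1) m)
      sums ((1 - q powr (c - a - b)) * K c - (1 - q powr (c - a)) * (1 - q powr (c - b)) * K (c + 1))"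
    using c by (intro sums_diff sums_mult sums) auto
  show ?thesis using sums_unique2[OF s0 s1] by simp
qed

text \<open>Iterating in c builds up the partial products of \<open>P (c - a)\<close> and
  \<open>P (c - b)\<close>; in the limit only the term m = 0 of the series remains.\<close>

theorem q_Gauss:
  assumes a: "a \<notin> \<int>\<^sub>\<le>\<^sub>0" and b: "b \<notin> \<int>\<^sub>\<le>\<^sub>0" and c: "c - a - b > 0"
  shows "(\<Sum>m. P (1 + real m) * P (c + real m) / (P (a + real m) * P (b + real m))
      * (q powr (c - a - b)) ^ m) = P 1 * P (c - a) * P (c - b) / (P a * P b * P (c - a - b))"
proof -
  define K where "K = (\<lambda>c. \<Sum>m. P (1 + real m) * P (c + real m) / (P (a + real m) * P (b + real m))
      * (q powr (c - a - b)) ^ m)"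
  have step: "K c * P (c - a - b) =
      (1 - q powr (c - a)) * (1 - q powr (c - b)) * (K (c + 1) * P (c - a - b + 1))"
    if "c - a - b > 0" for c
  proof -
    have "(1 - q powr (c - a - b)) * K c = (1 - q powr (c - a)) * (1 - q powr (c - b)) * K (c + 1)"
      unfolding K_def by (rule Gauss_contiguous[OF a b that])
    then show ?thesis by (subst P_rec) (simp add: mult_ac)
  qed
  have iter: "K c * P (c - a - b) =
      (\<Prod>k<N. 1 - q powr (c - a + real k)) * (\<Prod>k<N. 1 - q powr (c - b + real k))
        * (K (c + real N) * P (c - a - b + real N))" for N
  proof (induction N)
    case (Suc N)
    have eqs: "c - a + real N - b = c - a - b + real N" "c + real N - a = c - a + real N"
        "c + real N - b = c - b + real N"
      by auto
    show ?case
      using step[of "c + real N"] c unfolding Suc.IH prod.lessThan_Suc eqs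
      by (simp add: add_ac mult_ac)
  qed simp
  obtain C where C: "\<And>k l m n. \<bar>P (1 + real k) * P (c + real l) / (P (a + real m) * P (b + real n))\<bar> \<le> C"
    using quotient2_bounded[OF a b, of 1 c] by blast
  have "(\<lambda>N. K (c + real N)) \<longlonglongrightarrow>
      (\<Sum>m. P (1 + real m) * 1 / (P (a + real m) * P (b + real m)) * 0 ^ m)"
    unfolding K_def
  proof (rule suminf_dominated_convergence)
    have w: "q powr (c + real N - a - b) = q powr (c - a - b) * q ^ N" for N
      using powr_add_nat[of "c - a - b" N] by (simp add: algebra_simps)
    have lim: "(\<lambda>N. P (c + real N + real m)) \<longlonglongrightarrow> 1" for m
      using P_tendsto_1[of "c + real m"] by (simp add: add_ac)
    show "(\<lambda>N. P (1 + real m) * P (c + real N + real m) / (P (a + real m) * P (b + real m))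
          * (q powr (c + real N - a - b)) ^ m)
        \<longlonglongrightarrow> P (1 + real m) * 1 / (P (a + real m) * P (b + real m)) * 0 ^ m" for m
      unfolding w divide_inverse using q_pos q_less_1
      by (intro tendsto_intros tendsto_mult_right_zero LIMSEQ_power_zero lim) auto
    show "\<bar>P (1 + real m) * P (c + real N + real m) / (P (a + real m) * P (b + real m))
          * (q powr (c + real N - a - b)) ^ m\<bar> \<le> C * (q powr (c - a - b)) ^ m" for N m
    proof -
      have "(q powr (c + real N - a - b)) ^ m \<le> (q powr (c - a - b)) ^ m"
        using q_pos q_less_1 by (intro power_mono) (auto simp: w mult_left_le power_le_one)
      moreover have "\<bar>P (1 + real m) * P (c + real N + real m) / (P (a + real m) * P (b + real m))\<bar> \<le> C"
        using C[of m "N + m" m m] by (simp add: add_ac)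
      moreover have "C \<ge> 0" using C[of 0 0 0 0] by linarith
      ultimately show ?thesis
        unfolding abs_mult[of _ "_ ^ _"] by (intro mult_mono) auto
    qed
    show "summable (\<lambda>k. C * (q powr (c - a - b)) ^ k)" using c by (rule summable_geometric_powr)
  qed
  then have "(\<lambda>N. (\<Prod>k<N. 1 - q powr (c - a + real k)) * (\<Prod>k<N. 1 - q powr (c - b + real k))
        * (K (c + real N) * P (c - a - b + real N)))
      \<longlonglongrightarrow> P (c - a) * P (c - b) * (P 1 / (P a * P b) * 1)"
    unfolding powser_zero by (intro tendsto_mult P_partial_prod P_tendsto_1) simp
  then have "K c * P (c - a - b) = P (c - a) * P (c - b) * (P 1 / (P a * P b))"
    unfolding iter[symmetric] by (simp add: LIMSEQ_const_iff)
  then have "K c = P 1 * P (c - a) * P (c - b) / (P a * P b * P (c - a - b))"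
    using P_pos[OF c] P_nonzero[OF a] P_nonzero[OF b] by (simp add: nonzero_eq_divide_eq mult_ac)
  then show ?thesis unfolding K_def .
qed

subsection \<open>Heine's transformation\<close>

text \<open>Term by term, \<open>H a - q powr z * H (a + 1)\<close> is 1 - q^z times a series to
  which \<open>q_Gauss\<close> applies, with parameters 1+z-d, a and a+z+1. The factor 1 - q^z then
  turns \<open>P (z + 1)\<close> into \<open>P z\<close>.\<close>

lemma Heine_contiguous:
  assumes a: "a \<notin> \<int>\<^sub>\<le>\<^sub>0" and e: "1 + z - d \<notin> \<int>\<^sub>\<le>\<^sub>0" and d: "d > 0"
  defines "H \<equiv> \<lambda>a. \<Sum>m. P (1 + real m) * P (a + z + real m) / (P (1 + z - d + real m) * P (a + real m))
      * (q powr d) ^ m"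
  shows "H a = P 1 * P z / (P (1 + z - d) * P d) * (P (a + d) / P a) + q powr z * H (a + 1)"
proof -
  let ?t = "\<lambda>a m. P (1 + real m) * P (a + z + real m) / (P (1 + z - d + real m) * P (a + real m))
      * (q powr d) ^ m"
  let ?g = "\<lambda>m. P (1 + real m) * P (a + z + 1 + real m) / (P (1 + z - d + real m) * P (a + real m))
      * (q powr d) ^ m"
  have sums: "?t a sums H a" if a: "a \<notin> \<int>\<^sub>\<le>\<^sub>0" for a
  proof -
    obtain C where "\<And>k l m n. \<bar>P (1 + real k) * P (a + z + real l) / (P (1 + z - d + real m) * P (a + real n))\<bar> \<le> C"
      using quotient2_bounded[OF e a, of 1 "a + z"] by blast
    from summable_bounded_geometric[OF d this] show ?thesis
      unfolding H_def by (rule summable_sums)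
  qed
  have a1: "a + 1 \<notin> \<int>\<^sub>\<le>\<^sub>0" using shift_not_nonpos[OF a, of 1] by simp
  have eq: "?t a m - q powr z * ?t (a + 1) m = (1 - q powr z) * ?g m" for m
  proof -
    define y where "y = q powr a * q ^ m"
    define R where "R = P (1 + real m) / P (1 + z - d + real m) * (q powr d) ^ m"
    have r: "P (a + real m) = (1 - y) * P (a + 1 + real m)"
        "P (a + z + real m) = (1 - q powr z * y) * P (a + z + 1 + real m)"
      using P_rec[of "a + real m"] P_rec[of "a + z + real m"]
      by (simp_all add: y_def powr_add powr_realpow q_pos add_ac mult_ac)
    have nz: "(1 - y) * P (a + 1 + real m) \<noteq> 0"
      using P_nonzero[OF shift_not_nonpos[OF a, of m]] unfolding r .
    have z1: "a + 1 + z = a + z + 1" by simp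
    have "?t a m - q powr z * ?t (a + 1) m = R * (P (a + z + real m) / P (a + real m)
        - q powr z * (P (a + z + 1 + real m) / P (a + 1 + real m)))"
      unfolding z1 by (simp add: R_def algebra_simps)
    also have "P (a + z + real m) / P (a + real m) - q powr z * (P (a + z + 1 + real m) / P (a + 1 + real m))
        = (1 - q powr z) * (P (a + z + 1 + real m) / P (a + real m))"
      unfolding r using nz by (simp add: divide_simps) (simp add: algebra_simps)
    finally show ?thesis by (simp add: R_def)
  qed
  have "(\<lambda>m. ?t a m - q powr z * ?t (a + 1) m) sums (H a - q powr z * H (a + 1))"
    by (intro sums_diff sums_mult sums a a1)
  moreover have "(\<lambda>m. ?t a m - q powr z * ?t (a + 1) m) sums ((1 - q powr z) * suminf ?g)"
  proof -
    obtain C where "\<And>k l m n. \<bar>P (1 + real k) * P (a + z + 1 + real l) / (P (1 + z - d + real m) * P (a + real n))\<bar> \<le> C"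
      using quotient2_bounded[OF e a, of 1 "a + z + 1"] by blast
    from summable_bounded_geometric[OF d this] show ?thesis
      unfolding eq by (intro sums_mult summable_sums)
  qed
  ultimately have "H a - q powr z * H (a + 1) = (1 - q powr z) * suminf ?g"
    by (rule sums_unique2)
  also have "suminf ?g = P 1 * P (a + d) * P (z + 1) / (P (1 + z - d) * P a * P d)"
    using q_Gauss[OF e a, of "a + z + 1"] d by (simp add: algebra_simps)
  also have "(1 - q powr z) * (P 1 * P (a + d) * P (z + 1) / (P (1 + z - d) * P a * P d))
      = (1 - q powr z) * P (z + 1) * (P 1 * P (a + d) / (P (1 + z - d) * P a * P d))"
    by simp
  also have "\<dots> = P 1 * P z / (P (1 + z - d) * P d) * (P (a + d) / P a)"
    unfolding P_rec[symmetric] by (simp add: mult_ac)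
  finally show ?thesis by simp
qed

text \<open>Unrolling the recursion in a produces the series in q^z on the right, which is a
  multiple of 2phi1(q, q^a; q^(a+d); q^z). The remainder
  \<open>(q powr z) ^ N * H (a + real N)\<close> tends to 0 because the values of \<open>H\<close>
  are uniformly bounded.\<close>

theorem Heine:
  assumes a: "a \<notin> \<int>\<^sub>\<le>\<^sub>0" and e: "1 + z - d \<notin> \<int>\<^sub>\<le>\<^sub>0" and d: "d > 0" and z: "z > 0"
  shows "(\<Sum>m. P (1 + real m) * P (a + z + real m) / (P (1 + z - d + real m) * P (a + real m))
      * (q powr d) ^ m)
    = P 1 * P z / (P (1 + z - d) * P d) * (\<Sum>n. P (a + d + real n) / P (a + real n) * (q powr z) ^ n)"
proof -
  define H where "H = (\<lambda>a. \<Sum>m. P (1 + real m) * P (a + z + real m)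
      / (P (1 + z - d + real m) * P (a + real m)) * (q powr d) ^ m)"
  define \<kappa> where "\<kappa> = P 1 * P z / (P (1 + z - d) * P d)"
  have step: "H a = \<kappa> * (P (a + d) / P a) + q powr z * H (a + 1)" if "a \<notin> \<int>\<^sub>\<le>\<^sub>0" for a
    unfolding H_def \<kappa>_def by (rule Heine_contiguous[OF that e d])
  have iter: "H a - (q powr z) ^ N * H (a + real N)
      = (\<Sum>n<N. \<kappa> * (P (a + d + real n) / P (a + real n) * (q powr z) ^ n))" for N
  proof (induction N)
    case (Suc N)
    have "H (a + real N) = \<kappa> * (P (a + d + real N) / P (a + real N)) + q powr z * H (a + real (Suc N))"
      using step[OF shift_not_nonpos[OF a, of N]] by (simp add: add_ac)
    then have "(q powr z) ^ N * H (a + real N) = \<kappa> * (P (a + d + real N) / P (a + real N) * (q powr z) ^ N)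
        + (q powr z) ^ Suc N * H (a + real (Suc N))"
      by (simp add: algebra_simps)
    then show ?case using Suc.IH by simp
  qed simp
  obtain C where C: "\<And>k l m n. \<bar>P (1 + real k) * P (a + z + real l) / (P (1 + z - d + real m) * P (a + real n))\<bar> \<le> C"
    using quotient2_bounded[OF e a, of 1 "a + z"] by blast
  have bound: "\<bar>H (a + real N)\<bar> \<le> (\<Sum>m. C * (q powr d) ^ m)" for N
  proof -
    have "\<bar>P (1 + real m) * P (a + real N + z + real m) / (P (1 + z - d + real m) * P (a + real N + real m))
        * (q powr d) ^ m\<bar> \<le> C * (q powr d) ^ m" for m
      using abs_mult_power_le[OF C[of m "N + m" m "N + m"], of d m] by (simp add: add_ac)
    then show ?thesis
      unfolding H_def real_norm_def[symmetric]
      by (intro norm_suminf_le summable_geometric_powr[OF d]) simp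
  qed
  have "(\<lambda>N. H (a + real N) * (q powr z) ^ N) \<longlonglongrightarrow> 0"
    by (rule mult_powr_power_tendsto_0[OF z bound])
  then have "(\<lambda>N. H a - (q powr z) ^ N * H (a + real N)) \<longlonglongrightarrow> H a - 0"
    by (intro tendsto_intros) (simp add: mult.commute)
  then have s: "(\<lambda>n. \<kappa> * (P (a + d + real n) / P (a + real n) * (q powr z) ^ n)) sums H a"
    unfolding iter sums_def by simp
  obtain D where D: "\<And>m n. \<bar>P (a + d + real n) / P (a + real m)\<bar> \<le> D"
    using quotient_bounded[OF a, of "a + d"] by blast
  then have "H a = \<kappa> * (\<Sum>n. P (a + d + real n) / P (a + real n) * (q powr z) ^ n)"
    unfolding sums_unique[OF s] by (intro suminf_mult summable_bounded_geometric[OF z])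
  then show ?thesis unfolding H_def \<kappa>_def .
qed

subsection \<open>Ramanujan's summation\<close>

lemma powr_mult_nat: "q powr (z * real n) = (q powr z) ^ n"
  using q_pos by (simp add: powr_powr[symmetric] powr_realpow)

text \<open>\<open>Q\<close> is antitone, so it bounds \<open>P (b + N - n)\<close> uniformly in \<open>N\<close> on the negative half of the series.\<close>

definition Q :: "real \<Rightarrow> real" where
  "Q s = qpoch_inf q (- (q powr s))"

lemma Q_rec: "Q s = (1 + q powr s) * Q (s + 1)"
  using qpoch_split[of "- (q powr s)" 1] q_pos by (simp add: Q_def powr_add)

text \<open>The estimate holds factor by factor: |1 - q^(s+i)| <= 1 + q^(t+i), since q^s <=
  q^t.\<close>

lemma abs_P_le_Q: assumes "t \<le> s" shows "\<bar>P s\<bar> \<le> Q t"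
proof -
  have "(\<lambda>n. \<bar>\<Prod>i\<le>n. 1 - q powr s * q ^ i\<bar>) \<longlonglongrightarrow> \<bar>P s\<bar>"
    unfolding P_def by (intro tendsto_rabs qpoch_LIMSEQ)
  moreover have "(\<lambda>n. \<Prod>i\<le>n. 1 - - (q powr t) * q ^ i) \<longlonglongrightarrow> Q t"
    unfolding Q_def by (rule qpoch_LIMSEQ)
  moreover have "\<bar>\<Prod>i\<le>n. 1 - q powr s * q ^ i\<bar> \<le> (\<Prod>i\<le>n. 1 - - (q powr t) * q ^ i)" for n
    unfolding abs_prod
  proof (intro prod_mono conjI)
    fix i
    have "q powr s * q ^ i \<le> q powr t * q ^ i"
      using q_pos q_less_1 assms by (intro mult_right_mono powr_mono') auto
    moreover have "0 \<le> q powr s * q ^ i" using q_pos by simp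
    ultimately show "\<bar>1 - q powr s * q ^ i\<bar> \<le> 1 - - (q powr t) * q ^ i" by (simp add: abs_le_iff)
  qed simp
  ultimately show ?thesis by (blast intro: LIMSEQ_le)
qed

text \<open>The index \<open>t\<close> is real, so that both halves of the bilateral series are
  instances of one expression and the shift t -> t+1 acts on them alike.\<close>

definition psi_term :: "real \<Rightarrow> real \<Rightarrow> real \<Rightarrow> real \<Rightarrow> real" where
  "psi_term a z b t = P (b + t) / P (a + t) * q powr (z * t)"

text \<open>\<open>psi a z b\<close> is \<open>P b / P a\<close> times \<open>\<^sub>1\<psi>\<^sub>1(q\<^sup>a; q\<^sup>b; q\<^sup>z)\<close>; this normalisation stays meaningful at integer \<open>b\<close>.\<close>

definition psi :: "real \<Rightarrow> real \<Rightarrow> real \<Rightarrow> real" where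
  "psi a z b = (\<Sum>n. psi_term a z b (real n)) + (\<Sum>n. psi_term a z b (- 1 - real n))"

lemma nonint_shift: "a \<notin> \<int> \<Longrightarrow> a + real n \<notin> \<int>" "a \<notin> \<int> \<Longrightarrow> a + (- 1 - real n) \<notin> \<int>" for a :: real
  using Ints_diff[of "a + real n" "real n"] Ints_diff[of "a + (- 1 - real n)" "- 1 - real n"] by auto

lemma psi_term_pos_bound:
  assumes "a \<notin> \<int>" and "z > 0"
  obtains M where "summable M" and "\<And>N n. \<bar>psi_term a z (b + real N) (real n)\<bar> \<le> M n"
proof -
  obtain C where C: "\<And>m n. \<bar>P (b + real n) / P (a + real m)\<bar> \<le> C"
    using quotient_bounded[OF nonint_not_nonpos[OF assms(1)], of b] by blast
  have "\<bar>psi_term a z (b + real N) (real n)\<bar> \<le> C * (q powr z) ^ n" for N n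
    using abs_mult_power_le[OF C[of "N + n" n], of z n]
    by (simp add: psi_term_def powr_mult_nat add_ac)
  with summable_geometric_powr[OF assms(2), of C] show ?thesis by (rule that)
qed

text \<open>The majorant, built with \<open>Q\<close> in place of \<open>P\<close>, does not depend
  on N. It is summable by the ratio test: its ratios tend to q^(b-a-z) < 1.\<close>

lemma psi_term_neg_bound:
  assumes a: "a \<notin> \<int>" and z: "z < b - a"
  obtains M where "summable M" and "\<And>N n. \<bar>psi_term a z (b + real N) (- 1 - real n)\<bar> \<le> M n"
proof -
  define M where "M = (\<lambda>n. Q (b + (- 1 - real n)) / \<bar>P (a + (- 1 - real n))\<bar> * q powr (z * (- 1 - real n)))"
  \<comment> \<open>This is the ratio \<open>M (Suc n) / M n\<close>. The new factors 1 + q^(b-2-n)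
    and 1 - q^(a-2-n) are both multiplied by q^n, so that the limit can be read off.\<close>
  define \<rho> where "\<rho> = (\<lambda>n. (q ^ n + q powr (b - 2)) / \<bar>q ^ n - q powr (a - 2)\<bar> * q powr (- z))"
  have Q0: "Q s \<ge> 0" for s using abs_P_le_Q[of s s] by linarith
  have M0: "M n \<ge> 0" for n by (simp add: M_def Q0)
  have step: "M (Suc n) = \<rho> n * M n" for n
  proof -
    have e: "q powr (s + (- 1 - real (Suc n))) = q powr (s - 2) / q ^ n" for s
      using powr_add_nat[of "s + (- 1 - real (Suc n))" n] q_pos by (simp add: field_simps)
    have "1 + q powr (b + (- 1 - real (Suc n))) = (q ^ n + q powr (b - 2)) / q ^ n"
      unfolding e using q_pos by (simp add: field_simps)
    moreover have ae: "s + (- 1 - real (Suc n)) + 1 = s + (- 1 - real n)" for s by simp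
    ultimately have rQ: "Q (b + (- 1 - real (Suc n))) = (q ^ n + q powr (b - 2)) / q ^ n * Q (b + (- 1 - real n))"
      by (subst Q_rec) (simp only:)
    have "1 - q powr (a + (- 1 - real (Suc n))) = (q ^ n - q powr (a - 2)) / q ^ n"
      unfolding e using q_pos by (simp add: field_simps)
    then have rP: "P (a + (- 1 - real (Suc n))) = (q ^ n - q powr (a - 2)) / q ^ n * P (a + (- 1 - real n))"
      by (subst P_rec) (simp only: ae)
    have rz: "q powr (z * (- 1 - real (Suc n))) = q powr (- z) * q powr (z * (- 1 - real n))"
      unfolding powr_add[symmetric] by (rule arg_cong[of _ _ "(powr) q"]) (simp add: algebra_simps)
    show ?thesis
      unfolding M_def \<rho>_def rQ rP rz abs_mult abs_divide using q_pos by simp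
  qed
  have "\<rho> \<longlonglongrightarrow> (0 + q powr (b - 2)) / \<bar>0 - q powr (a - 2)\<bar> * q powr (- z)"
    unfolding \<rho>_def using q_pos q_less_1
    by (intro tendsto_intros LIMSEQ_power_zero) auto
  also have "(0 + q powr (b - 2)) / \<bar>0 - q powr (a - 2)\<bar> * q powr (- z) = q powr (b - a - z)"
    by (simp add: powr_diff[symmetric] powr_add[symmetric])
  finally have lim: "\<rho> \<longlonglongrightarrow> q powr (b - a - z)" .
  have "q powr (b - a - z) < 1" using z by (intro powr_less_1) simp
  then obtain c where c: "q powr (b - a - z) < c" "c < 1" using dense by blast
  from order_tendstoD(2)[OF lim c(1)] obtain n0 where n0: "\<And>n. n \<ge> n0 \<Longrightarrow> \<rho> n < c"
    by (auto simp: eventually_sequentially)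
  have "summable M"
  proof (rule summable_ratio_test[OF c(2)])
    fix n assume "n \<ge> n0"
    from n0[OF this] show "norm (M (Suc n)) \<le> c * norm (M n)"
      unfolding step using M0[of n] M0[of "Suc n"] unfolding step by (simp add: mult_right_mono)
  qed
  moreover have "\<bar>psi_term a z (b + real N) (- 1 - real n)\<bar> \<le> M n" for N n
  proof -
    have "\<bar>P (b + real N + (- 1 - real n))\<bar> \<le> Q (b + (- 1 - real n))" by (rule abs_P_le_Q) simp
    then show ?thesis
      unfolding psi_term_def M_def by (simp add: abs_mult mult_right_mono divide_right_mono)
  qed
  ultimately show ?thesis by (rule that)
qed

lemma psi_summable:
  assumes "a \<notin> \<int>" "z > 0" "z < b - a"
  shows "summable (\<lambda>n. psi_term a z b (real n))" "summable (\<lambda>n. psi_term a z b (- 1 - real n))"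
proof -
  obtain M where "summable M" "\<And>N n. \<bar>psi_term a z (b + real N) (real n)\<bar> \<le> M n"
    using psi_term_pos_bound[OF assms(1,2)] by blast
  from this(1) this(2)[of 0] show "summable (\<lambda>n. psi_term a z b (real n))"
    by - (rule summable_comparison_test'[of M 0], auto)
  obtain M where "summable M" "\<And>N n. \<bar>psi_term a z (b + real N) (- 1 - real n)\<bar> \<le> M n"
    using psi_term_neg_bound[OF assms(1,3)] by blast
  from this(1) this(2)[of 0] show "summable (\<lambda>n. psi_term a z b (- 1 - real n))"
    by - (rule summable_comparison_test'[of M 0], auto)
qed

text \<open>The left series is the right one with its index shifted by one. This moves a by an
  integer while b - a stays fixed.\<close>

lemma psi_shift:
  assumes "a \<notin> \<int>" "z > 0" "z < b - a"
  shows "psi (a + 1) z (b + 1) = q powr (- z) * psi a z b"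
proof -
  have e: "psi_term (a + 1) z (b + 1) t = q powr (- z) * psi_term a z b (t + 1)" for t
    by (simp add: psi_term_def powr_add[symmetric] algebra_simps)
  note S = bilateral_suminf_shift[OF psi_summable[OF assms]]
  show ?thesis
    unfolding psi_def e S(3)[symmetric] suminf_mult[OF S(1)] suminf_mult[OF S(2)]
    by (simp add: algebra_simps)
qed

text \<open>Each term is a combination of the same term at b+1 and the next term at b. Over all
  integers the index shift is invisible, so the relation can be solved for
  \<open>psi a z b\<close>.\<close>

lemma psi_contiguous:
  assumes "a \<notin> \<int>" "z > 0" "z < b - a"
  shows "(1 - q powr (b - a - z)) * psi a z b = (1 - q powr (b - a)) * psi a z (b + 1)"
proof -
  \<comment> \<open>With A = q^(a+t) and w = q^(b-a) this is 1 - wA = (1 - w) + w(1 - A), divided by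
    1 - A.\<close>
  have term_eq: "psi_term a z b t = (1 - q powr (b - a)) * psi_term a z (b + 1) t
      + q powr (b - a - z) * psi_term a z b (t + 1)" if "P (a + t) \<noteq> 0" for t
  proof -
    define A where "A = q powr (a + t)"
    define w where "w = q powr (b - a)"
    have B: "q powr (b + t) = w * A" by (simp add: A_def w_def powr_add[symmetric])
    have r: "P (a + t) = (1 - A) * P (a + t + 1)" "P (b + t) = (1 - w * A) * P (b + t + 1)"
      using P_rec[of "a + t"] P_rec[of "b + t"] by (simp_all add: A_def B)
    have nz: "1 - A \<noteq> 0" "P (a + t + 1) \<noteq> 0" using that unfolding r by auto
    have x: "q powr (b - a - z) * q powr (z * (t + 1)) = w * q powr (z * t)"
      by (simp add: w_def powr_add[symmetric] algebra_simps)
    have "q powr (b - a - z) * psi_term a z b (t + 1) = w * (P (b + t + 1) / P (a + t + 1)) * q powr (z * t)"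
      unfolding psi_term_def using x by (simp add: add_ac mult_ac)
    moreover have "psi_term a z (b + 1) t = P (b + t + 1) / ((1 - A) * P (a + t + 1)) * q powr (z * t)"
      unfolding psi_term_def r by (simp add: add_ac)
    moreover have "psi_term a z b t = (1 - w * A) * P (b + t + 1) / ((1 - A) * P (a + t + 1)) * q powr (z * t)"
      unfolding psi_term_def r ..
    moreover have "(1 - w * A) * Y / ((1 - A) * X) * Z = (1 - w) * (Y / ((1 - A) * X) * Z) + w * (Y / X) * Z"
      if "X \<noteq> 0" for X Y Z
      using nz(1) that by (simp add: divide_simps) (simp add: algebra_simps)
    ultimately show ?thesis using nz(2) by (simp add: w_def)
  qed
  note T = psi_summable[OF assms] and T1 = psi_summable[of a z "b + 1"]
  note S = bilateral_suminf_shift[OF T]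
  have sum: "(\<Sum>n. psi_term a z b (v n)) = (1 - q powr (b - a)) * (\<Sum>n. psi_term a z (b + 1) (v n))
      + q powr (b - a - z) * (\<Sum>n. psi_term a z b (v n + 1))"
    if "\<And>n. a + v n \<notin> \<int>" "summable (\<lambda>n. psi_term a z (b + 1) (v n))"
      "summable (\<lambda>n. psi_term a z b (v n + 1))" for v :: "nat \<Rightarrow> real"
  proof -
    have "(\<Sum>n. psi_term a z b (v n)) = (\<Sum>n. (1 - q powr (b - a)) * psi_term a z (b + 1) (v n)
        + q powr (b - a - z) * psi_term a z b (v n + 1))"
      by (intro suminf_cong term_eq P_nonzero nonint_not_nonpos that)
    also have "\<dots> = (1 - q powr (b - a)) * (\<Sum>n. psi_term a z (b + 1) (v n))
      + q powr (b - a - z) * (\<Sum>n. psi_term a z b (v n + 1))"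
      using that(2,3) by (simp add: suminf_add[symmetric] suminf_mult summable_mult)
    finally show ?thesis .
  qed
  have "psi a z b = (1 - q powr (b - a)) * psi a z (b + 1) + q powr (b - a - z) *
      ((\<Sum>n. psi_term a z b (real n + 1)) + (\<Sum>n. psi_term a z b (- 1 - real n + 1)))"
    unfolding psi_def
    using sum[OF nonint_shift(1)[OF assms(1)] T1(1) S(1)] sum[OF nonint_shift(2)[OF assms(1)] T1(2) S(2)] assms
    by (simp add: algebra_simps)
  then have "psi a z b = (1 - q powr (b - a)) * psi a z (b + 1) + q powr (b - a - z) * psi a z b"
    unfolding S(3) psi_def[symmetric] .
  then show ?thesis by (simp add: algebra_simps)
qed

text \<open>What matters is that b has disappeared from the limit.\<close>

lemma psi_tendsto:
  assumes "a \<notin> \<int>" "z > 0" "z < b - a"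
  shows "(\<lambda>N. psi a z (b + real N)) \<longlonglongrightarrow> (\<Sum>n. 1 / P (a + real n) * q powr (z * real n))
    + (\<Sum>n. 1 / P (a + (- 1 - real n)) * q powr (z * (- 1 - real n)))"
proof -
  have lim: "(\<lambda>N. psi_term a z (b + real N) t) \<longlonglongrightarrow> 1 / P (a + t) * q powr (z * t)" for t
  proof -
    have "(\<lambda>N. P (b + real N + t)) \<longlonglongrightarrow> 1"
      using P_tendsto_1[of "b + t"] by (simp add: add_ac)
    then show ?thesis unfolding psi_term_def divide_inverse by (intro tendsto_intros)
  qed
  obtain M where M: "summable M" "\<And>N n. \<bar>psi_term a z (b + real N) (real n)\<bar> \<le> M n"
    using psi_term_pos_bound[OF assms(1,2)] by blast
  obtain M' where M': "summable M'" "\<And>N n. \<bar>psi_term a z (b + real N) (- 1 - real n)\<bar> \<le> M' n"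
    using psi_term_neg_bound[OF assms(1,3)] by blast
  show ?thesis unfolding psi_def
    by (intro tendsto_add suminf_dominated_convergence[OF lim M(2,1)] suminf_dominated_convergence[OF lim M'(2,1)])
qed

text \<open>The quotient of \<open>P\<close> values makes the left side invariant under b -> b+1 and
  itself tends to 1. The left side therefore equals the limit of \<open>psi\<close>, and its values
  at two different b can be compared.\<close>

lemma psi_normalized:
  assumes "a \<notin> \<int>" "z > 0" "z < b - a"
  shows "psi a z b * (P (b - a - z) / P (b - a)) = (\<Sum>n. 1 / P (a + real n) * q powr (z * real n))
    + (\<Sum>n. 1 / P (a + (- 1 - real n)) * q powr (z * (- 1 - real n)))" (is "_ = ?L")
proof -
  define R where "R = (\<lambda>b. psi a z b * (P (b - a - z) / P (b - a)))"
  have step: "R (b + 1) = R b" if "z < b - a" for b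
  proof -
    have "b - a > 0" "b - a - z > 0" using that assms by auto
    then have nz: "P (b + 1 - a) > 0" "1 - q powr (b - a) > 0"
      by (auto intro: P_pos powr_less_1)
    have "R b = (1 - q powr (b - a - z)) * psi a z b * (P (b + 1 - a - z) / ((1 - q powr (b - a)) * P (b + 1 - a)))"
      unfolding R_def P_rec[of "b - a - z"] P_rec[of "b - a"] by (simp add: algebra_simps)
    also have "\<dots> = R (b + 1)"
      unfolding psi_contiguous[OF assms(1,2) that] R_def using nz by simp
    finally show ?thesis ..
  qed
  have iter: "R (b + real N) = R b" for N
  proof (induction N)
    case (Suc N)
    then show ?case using step[of "b + real N"] assms by (simp add: add_ac)
  qed simp
  have lims: "(\<lambda>N. P (b + real N - a - z)) \<longlonglongrightarrow> 1" "(\<lambda>N. P (b + real N - a)) \<longlonglongrightarrow> 1"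
    using P_tendsto_1[of "b - a - z"] P_tendsto_1[of "b - a"] by (simp_all add: algebra_simps)
  have "(\<lambda>N. R (b + real N)) \<longlonglongrightarrow> ?L * (1 / 1)"
    unfolding R_def by (intro tendsto_mult tendsto_divide psi_tendsto assms lims) auto
  then show ?thesis unfolding iter by (simp add: LIMSEQ_const_iff R_def)
qed

text \<open>This is the theta function (x)_inf (q/x)_inf at x = q^s.\<close>

definition \<theta> :: "real \<Rightarrow> real" where
  "\<theta> s = P s * P (1 - s)"

lemma \<theta>_shift: "\<theta> s = - (q powr s) * \<theta> (s + 1)"
proof -
  have "P s * P (1 - s) * (1 - q powr (- s)) = (1 - q powr s) * P (s + 1) * P (- s)"
    using P_rec[of s] P_rec[of "- s"] by simp
  also have "1 - q powr s = - (q powr s) * (1 - q powr (- s))"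
    using q_pos by (simp add: algebra_simps powr_add[symmetric])
  finally have *: "(1 - q powr (- s)) * \<theta> s = (1 - q powr (- s)) * (- (q powr s) * \<theta> (s + 1))"
    by (simp add: \<theta>_def mult_ac)
  show ?thesis
  \<comment> \<open>At s = 0 the factor to be cancelled vanishes; there both sides are 0, since each
    contains \<open>P 0\<close>.\<close>
  proof (cases "s = 0")
    case True
    then show ?thesis using P_nonpos_nat[of 0] by (simp add: \<theta>_def)
  next
    case False
    then have "q powr (- s) \<noteq> 1" using q_pos q_less_1 powr_inj[of q "- s" 0] by auto
    then show ?thesis using * by (metis mult_cancel_left right_minus_eq)
  qed
qed

lemma \<theta>_nonzero: "s \<notin> \<int> \<Longrightarrow> \<theta> s \<noteq> 0"
  using P_nonzero[OF nonint_not_nonpos, of s] P_nonzero[OF nonint_not_nonpos, of "1 - s"]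
    Ints_diff[OF Ints_1, of "1 - s"] by (auto simp: \<theta>_def)

text \<open>By \<open>psi_normalized\<close> the sum may be evaluated at b = 1, but that value is
  admissible only if z < 1 - a. Other a are lowered into this range by
  \<open>psi_shift\<close>.\<close>

theorem Ramanujan_psi_sum:
  assumes "a \<notin> \<int>" "z > 0" "z < b - a"
  shows "psi a z b = P 1 * P (b - a) * \<theta> (a + z) / (\<theta> a * P z * P (b - a - z))"
proof -
  have base: "psi a z b = P 1 * P (b - a) * \<theta> (a + z) / (\<theta> a * P z * P (b - a - z))"
    if a: "a \<notin> \<int>" and zb: "z < b - a" and z1: "z < 1 - a" for a b
  proof -
    \<comment> \<open>At b = 1 the numerator is \<open>P (- real n)\<close>, so the negative half
      vanishes and a q-binomial series remains.\<close>
    have "psi_term a z 1 (- 1 - real n) = 0" for n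
      using P_nonpos_nat[of n] by (simp add: psi_term_def)
    then have "psi a z 1 = (\<Sum>k. P (1 + real k) / P (a + real k) * (q powr z) ^ k)"
      by (simp add: psi_def) (simp add: psi_term_def powr_mult_nat)
    also have "\<dots> = P 1 * P (a + z) / (P a * P z)"
      by (rule q_binomial[OF nonint_not_nonpos[OF a] assms(2)])
    finally have psi1: "psi a z 1 = P 1 * P (a + z) / (P a * P z)" .
    have "psi a z b * (P (b - a - z) / P (b - a)) = psi a z 1 * (P (1 - a - z) / P (1 - a))"
      using psi_normalized[OF a assms(2) zb] psi_normalized[OF a assms(2) z1] by simp
    moreover have "P (b - a - z) > 0" "P (b - a) > 0" using zb assms(2) by (auto intro: P_pos)
    moreover have "y = d / c * x" if "y * (c / d) = x" "c > 0" "d > 0" for x y c d :: real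
      using that by auto
    ultimately have "psi a z b = P (b - a) / P (b - a - z) * (psi a z 1 * (P (1 - a - z) / P (1 - a)))"
      by blast
    then show ?thesis unfolding psi1 by (simp add: \<theta>_def mult_ac diff_diff_add)
  qed
  \<comment> \<open>\<open>M\<close> bounds how many unit steps a has to be lowered before z < 1 - a
    holds; b is lowered along with it.\<close>
  have shift: "psi a z b = P 1 * P (b - a) * \<theta> (a + z) / (\<theta> a * P z * P (b - a - z))"
    if "a \<notin> \<int>" "z < b - a" "z < 1 - a + real M" for a b M
    using that
  proof (induction M arbitrary: a b)
    case 0
    then show ?case using base by simp
  next
    case (Suc M)
    have a': "a - 1 \<notin> \<int>" using Suc.prems(1) Ints_add[of "a - 1" 1] by auto
    have "psi a z b = q powr (- z) * psi (a - 1) z (b - 1)"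
      using psi_shift[OF a' assms(2), of "b - 1"] Suc.prems by simp
    also have "psi (a - 1) z (b - 1) = P 1 * P (b - a) * \<theta> (a - 1 + z) / (\<theta> (a - 1) * P z * P (b - a - z))"
      using Suc.IH[OF a', of "b - 1"] Suc.prems by (simp add: add_ac)
    \<comment> \<open>The quotient of the two theta shifts is q^z, which cancels the factor q^(-z)
      from \<open>psi_shift\<close>.\<close>
    also have "\<theta> (a - 1 + z) = - (q powr (a - 1)) * q powr z * \<theta> (a + z)"
      using \<theta>_shift[of "a - 1 + z"] by (simp add: powr_add add_ac)
    also have "\<theta> (a - 1) = - (q powr (a - 1)) * \<theta> a"
      using \<theta>_shift[of "a - 1"] by simp
    finally show ?case
      using q_pos by (simp add: powr_minus mult_ac)
  qed
  obtain M where "z - 1 + a < real M" using reals_Archimedean2 by blast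
  then show ?thesis using shift[OF assms(1,3), of M] by simp
qed

text \<open>Writing \<open>P s\<close> as \<open>\<theta> s / P (1 - s)\<close> and using the
  quasi-periodicity of \<open>\<theta>\<close> turns negative indices into positive ones, with
  parameters 1 - a and 1 - b.\<close>

lemma P_reflect_quotient:
  assumes "a \<notin> \<int>" "b \<notin> \<int>"
  shows "P (b - real m) / P (a - real m) = \<theta> b / \<theta> a * (q powr (b - a)) ^ m * (P (1 - a + real m) / P (1 - b + real m))"
proof -
  have quot: "\<theta> (b - real m) / \<theta> (a - real m) = \<theta> b / \<theta> a * (q powr (b - a)) ^ m" for m
  proof (induction m)
    case (Suc m)
    have r: "\<theta> (s - real (Suc m)) = - (q powr (s - real (Suc m))) * \<theta> (s - real m)" for s
      using \<theta>_shift[of "s - real (Suc m)"] by simp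
    have e: "q powr (b - real (Suc m)) = q powr (a - real (Suc m)) * q powr (b - a)"
      unfolding powr_add[symmetric] by (rule arg_cong[of _ _ "(powr) q"]) simp
    have "\<theta> (b - real (Suc m)) / \<theta> (a - real (Suc m)) = q powr (b - a) * (\<theta> (b - real m) / \<theta> (a - real m))"
      unfolding r e using q_pos by simp
    then show ?case unfolding Suc.IH by simp
  qed simp
  have nz: "P (1 - s + real m) \<noteq> 0" if "s \<notin> \<int>" for s
    using that nonint_shift(1)[of "1 - s" m] Ints_diff[OF Ints_1, of "1 - s"]
    by (intro P_nonzero nonint_not_nonpos) auto
  have "P (s - real m) = \<theta> (s - real m) / P (1 - s + real m)" if "s \<notin> \<int>" for s
    using nz[OF that] by (simp add: \<theta>_def algebra_simps)
  then show ?thesis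
    using assms unfolding quot[symmetric] by simp
qed

text \<open>Reflection turns the negative half into a series of the same kind that starts at index
  1. Completing it by its term of index 0 costs the subtracted \<open>P b / P a\<close>.\<close>

lemma psi_two_series:
  assumes "a \<notin> \<int>" "b \<notin> \<int>" "z > 0" "z < b - a"
  shows "psi a z b = (\<Sum>n. P (b + real n) / P (a + real n) * (q powr z) ^ n)
    + \<theta> b / \<theta> a * (\<Sum>n. P (1 - a + real n) / P (1 - b + real n) * (q powr (b - a - z)) ^ n) - P b / P a"
proof -
  let ?v = "\<lambda>n. P (1 - a + real n) / P (1 - b + real n) * (q powr (b - a - z)) ^ n"
  have b': "1 - b \<notin> \<int>" using assms(2) Ints_diff[OF Ints_1, of "1 - b"] by auto
  obtain C where C: "\<And>m n. \<bar>P (1 - a + real n) / P (1 - b + real m)\<bar> \<le> C"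
    using quotient_bounded[OF nonint_not_nonpos[OF b'], of "1 - a"] by blast
  have sv: "summable ?v" using assms(4) by (intro summable_bounded_geometric[OF _ C]) simp
  have "psi_term a z b (- 1 - real n) = \<theta> b / \<theta> a * ?v (Suc n)" for n
  proof -
    have "psi_term a z b (- 1 - real n) = P (b - real (Suc n)) / P (a - real (Suc n)) * q powr (- (z * real (Suc n)))"
      by (simp add: psi_term_def algebra_simps)
    also have "q powr (- (z * real (Suc n))) = 1 / (q powr z) ^ Suc n"
      by (simp only: powr_minus powr_mult_nat divide_inverse mult_1)
    also have "P (b - real (Suc n)) / P (a - real (Suc n)) * (1 / (q powr z) ^ Suc n) = \<theta> b / \<theta> a * ?v (Suc n)"
      unfolding P_reflect_quotient[OF assms(1,2)] powr_diff[of q "b - a" z] power_divide by (simp add: mult_ac)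
    finally show ?thesis .
  qed
  then have "(\<Sum>n. psi_term a z b (- 1 - real n)) = \<theta> b / \<theta> a * (\<Sum>n. ?v (Suc n))"
    by (simp only: suminf_mult[OF summable_Suc_iff[THEN iffD2, OF sv]])
  also have "(\<Sum>n. ?v (Suc n)) = suminf ?v - P (1 - a) / P (1 - b)"
    using suminf_split_head[OF sv] by simp
  also have "\<theta> b / \<theta> a * (suminf ?v - P (1 - a) / P (1 - b)) = \<theta> b / \<theta> a * suminf ?v - P b / P a"
    using \<theta>_nonzero[OF assms(1)] \<theta>_nonzero[OF assms(2)] by (simp add: \<theta>_def right_diff_distrib)
  finally show ?thesis by (simp add: psi_def) (simp add: psi_term_def powr_mult_nat)
qed

section \<open>Translation into q-gamma functions and q-integrals, and the final identity\<close>

lemma Gamma_q_real: "Gamma_q q x = P 1 / P x * (1 - q) powr (1 - x)" for x :: real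
  using q_pos by (simp add: Gamma_q_def P_def)

text \<open>This is the common shape of \<open>f\<close> and \<open>g\<close>, with d = b - a. At x
  = q^m the power x^(d-1) and the weight q^m combine to q^(dm), which gives the left-hand series of
  \<open>Heine\<close>.\<close>

lemma jackson_integral_quotient:
  "jackson_integral q 1 (\<lambda>x. qpoch_inf q (x * q) * qpoch_inf q (x * q powr c)
      / (qpoch_inf q (x * q powr s) * qpoch_inf q (x * q powr t)) * x powr (d - 1))
    = (1 - q) * (\<Sum>m. P (1 + real m) * P (c + real m) / (P (s + real m) * P (t + real m)) * (q powr d) ^ m)"
proof -
  have "(q ^ m) powr (d - 1) * q ^ m = (q powr d) ^ m" for m
  proof -
    have "(q ^ m) powr (d - 1) * q ^ m = (q powr real m) powr (d - 1) * q powr (real m)"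
      using q_pos by (simp add: powr_realpow)
    also have "\<dots> = q powr (d * real m)"
      by (simp add: powr_powr powr_add[symmetric] algebra_simps)
    finally show ?thesis by (simp add: powr_mult_nat)
  qed
  moreover have "qpoch_inf q (q ^ m * q powr u) = P (u + real m)" for u m
    by (simp add: P_def powr_add_nat mult.commute)
  moreover have "qpoch_inf q (q ^ m * q) = P (1 + real m)" for m
    using q_pos by (simp add: P_def powr_add_nat mult.commute)
  ultimately show ?thesis
    by (simp add: jackson_integral_def mult.assoc)
qed

end

theorem theorem5p3:
  fixes q a b z :: real and f g :: "real \<Rightarrow> real"
  assumes "0 < q" and "q < 1"
    and "0 < z" and "z < b - a" and "b - a < 1"
    and "a \<notin> \<int>" and "b \<notin> \<int>"
  defines "f \<equiv> \<lambda>x. qpoch_inf q (x * q) * qpoch_inf q (x * q powr (1 - a - z))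
      / (qpoch_inf q (x * q powr (1 - z)) * qpoch_inf q (x * q powr (1 - b)))
      * x powr (b - a - 1)"
    and "g \<equiv> \<lambda>x. qpoch_inf q (x * q) * qpoch_inf q (x * q powr (a + z))
      / (qpoch_inf q (x * q powr (a + 1 + z - b)) * qpoch_inf q (x * q powr a))
      * x powr (b - a - 1)"
  shows "Gamma_q q b * Gamma_q q (1 - a) * Gamma_q q z * Gamma_q q (b - a - z)
      / (Gamma_q q (b - a) * Gamma_q q (a + z) * Gamma_q q (1 - a - z))
    = - ((1 - q) powr (a + 1 - b))
      + Gamma_q q (1 - a) * Gamma_q q (b - a - z)
        / (Gamma_q q (b - a) * Gamma_q q (1 - z) * Gamma_q q (1 - b)) * jackson_integral q 1 f
      + Gamma_q q b * Gamma_q q z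
        / (Gamma_q q (b - a) * Gamma_q q (a + 1 + z - b) * Gamma_q q a) * jackson_integral q 1 g"
proof -
  interpret q_base q using assms by unfold_locales
  define F where "F = (\<Sum>n. P (b + real n) / P (a + real n) * (q powr z) ^ n)"
  define F' where "F' = (\<Sum>n. P (1 - a + real n) / P (1 - b + real n) * (q powr (b - a - z)) ^ n)"
  define E where "E = (1 - q) powr (a + 1 - b)"
  have b': "1 - b \<notin> \<int>" using assms(7) Ints_diff[OF Ints_1, of "1 - b"] by auto
  have a': "1 - a \<notin> \<int>" using assms(6) Ints_diff[OF Ints_1, of "1 - a"] by auto
  \<comment> \<open>The bound b - a < 1 gives 1 - z > 0 and a + 1 + z - b > 0.\<close>
  have Ppos: "P 1 > 0" "P z > 0" "P (b - a - z) > 0" "P (b - a) > 0" "P (1 - z) > 0" "P (a + 1 + z - b) > 0"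
    using assms(3-5) by (auto intro!: P_pos)
  have Pnz: "P a \<noteq> 0" "P b \<noteq> 0" "P (1 - a) \<noteq> 0" "P (1 - b) \<noteq> 0"
    by (intro P_nonzero nonint_not_nonpos assms a' b')+
  have nonpos: "x \<notin> \<int>\<^sub>\<le>\<^sub>0" if "x > 0" for x :: real
    using that by (auto elim: nonpos_Ints_cases)

  have Jg: "jackson_integral q 1 g = (1 - q) * (P 1 * P z / (P (a + 1 + z - b) * P (b - a)) * F)"
    unfolding g_def jackson_integral_quotient
    using Heine[of a z "b - a"] nonint_not_nonpos[OF assms(6)] nonpos[of "1 + z - (b - a)"] assms(3-5)
    by (simp add: F_def algebra_simps)
  \<comment> \<open>This is the evaluation of the integral of \<open>g\<close> under the interchange
    (a, z) -> (1 - b, b - a - z), which fixes b - a.\<close>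
  have Jf: "jackson_integral q 1 f = (1 - q) * (P 1 * P (b - a - z) / (P (1 - z) * P (b - a)) * F')"
    unfolding f_def jackson_integral_quotient
    using Heine[of "1 - b" "b - a - z" "b - a"] nonint_not_nonpos[OF b'] nonpos[of "1 - z"] assms(3-5)
    by (simp add: F'_def algebra_simps)

  \<comment> \<open>All terms carry the same power \<open>E\<close> of 1 - q; in the integral terms
    the prefactor 1 - q of the Jackson integral completes the exponent.\<close>
  have powers: "(1 - q) powr x * (1 - q) powr y = (1 - q) powr (x + y)"
      "(1 - q) powr x / (1 - q) powr y = (1 - q) powr (x - y)"
      "(1 - q) powr x * (1 - q) = (1 - q) powr (x + 1)" for x y
    using assms(2) by (auto simp: powr_add powr_diff)

  \<comment> \<open>If a + z is an integer, \<open>P (a + z)\<close> or \<open>P (1 - a - z)\<close>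
    is 0 and the corresponding \<open>Gamma_q\<close> has the default value 0. Division by it gives
    0, in agreement with the product on the right.\<close>
  have "Gamma_q q b * Gamma_q q (1 - a) * Gamma_q q z * Gamma_q q (b - a - z)
      / (Gamma_q q (b - a) * Gamma_q q (a + z) * Gamma_q q (1 - a - z))
    = P 1 * P (b - a) * (P (a + z) * P (1 - a - z)) / (P b * P (1 - a) * P z * P (b - a - z))
      * ((1 - q) powr (1 - b) * (1 - q) powr (1 - (1 - a)) * (1 - q) powr (1 - z) * (1 - q) powr (1 - (b - a - z))
        / ((1 - q) powr (1 - (b - a)) * (1 - q) powr (1 - (a + z)) * (1 - q) powr (1 - (1 - a - z))))"
    unfolding Gamma_q_real using Ppos(1) by (simp add: mult_ac)
  also have "(1 - q) powr (1 - b) * (1 - q) powr (1 - (1 - a)) * (1 - q) powr (1 - z) * (1 - q) powr (1 - (b - a - z))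
        / ((1 - q) powr (1 - (b - a)) * (1 - q) powr (1 - (a + z)) * (1 - q) powr (1 - (1 - a - z))) = E"
    unfolding powers E_def by (rule arg_cong[of _ _ "(powr) (1 - q)"]) simp
  finally have lhs: "Gamma_q q b * Gamma_q q (1 - a) * Gamma_q q z * Gamma_q q (b - a - z)
      / (Gamma_q q (b - a) * Gamma_q q (a + z) * Gamma_q q (1 - a - z))
    = P 1 * P (b - a) * (P (a + z) * P (1 - a - z)) / (P b * P (1 - a) * P z * P (b - a - z)) * E" .

  have "Gamma_q q (1 - a) * Gamma_q q (b - a - z)
        / (Gamma_q q (b - a) * Gamma_q q (1 - z) * Gamma_q q (1 - b)) * jackson_integral q 1 f
    = P (1 - b) / P (1 - a) * F' * ((1 - q) powr (1 - (1 - a)) * (1 - q) powr (1 - (b - a - z))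
        / ((1 - q) powr (1 - (b - a)) * (1 - q) powr (1 - (1 - z)) * (1 - q) powr (1 - (1 - b))) * (1 - q))"
    unfolding Gamma_q_real Jf using Ppos by (simp add: mult_ac)
  also have "(1 - q) powr (1 - (1 - a)) * (1 - q) powr (1 - (b - a - z))
        / ((1 - q) powr (1 - (b - a)) * (1 - q) powr (1 - (1 - z)) * (1 - q) powr (1 - (1 - b))) * (1 - q) = E"
    unfolding powers E_def by (rule arg_cong[of _ _ "(powr) (1 - q)"]) simp
  finally have f_term: "Gamma_q q (1 - a) * Gamma_q q (b - a - z)
        / (Gamma_q q (b - a) * Gamma_q q (1 - z) * Gamma_q q (1 - b)) * jackson_integral q 1 f
    = P (1 - b) / P (1 - a) * F' * E" .

  have "Gamma_q q b * Gamma_q q z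
        / (Gamma_q q (b - a) * Gamma_q q (a + 1 + z - b) * Gamma_q q a) * jackson_integral q 1 g
    = P a / P b * F * ((1 - q) powr (1 - b) * (1 - q) powr (1 - z)
        / ((1 - q) powr (1 - (b - a)) * (1 - q) powr (1 - (a + 1 + z - b)) * (1 - q) powr (1 - a)) * (1 - q))"
    unfolding Gamma_q_real Jg using Ppos by (simp add: mult_ac)
  also have "(1 - q) powr (1 - b) * (1 - q) powr (1 - z)
        / ((1 - q) powr (1 - (b - a)) * (1 - q) powr (1 - (a + 1 + z - b)) * (1 - q) powr (1 - a)) * (1 - q) = E"
    unfolding powers E_def by (rule arg_cong[of _ _ "(powr) (1 - q)"]) simp
  finally have g_term: "Gamma_q q b * Gamma_q q z
        / (Gamma_q q (b - a) * Gamma_q q (a + 1 + z - b) * Gamma_q q a) * jackson_integral q 1 g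
    = P a / P b * F * E" .

  have "P 1 * P (b - a) * \<theta> (a + z) / (\<theta> a * P z * P (b - a - z)) = F + \<theta> b / \<theta> a * F' - P b / P a"
    using Ramanujan_psi_sum[OF assms(6,3,4)] psi_two_series[OF assms(6,7,3,4)]
    by (simp only: F_def F'_def)
  \<comment> \<open>Multiplication by \<open>P a / P b\<close> turns the subtracted
    \<open>P b / P a\<close> into the summand -1 and restores the coefficients of both
    integrals.\<close>
  then have "P a / P b * (P 1 * P (b - a) * \<theta> (a + z) / (\<theta> a * P z * P (b - a - z)))
      = P a / P b * (F + \<theta> b / \<theta> a * F' - P b / P a)"
    by (rule arg_cong)
  moreover have "P a / P b * (P 1 * P (b - a) * \<theta> (a + z) / (\<theta> a * P z * P (b - a - z)))
      = P 1 * P (b - a) * (P (a + z) * P (1 - a - z)) / (P b * P (1 - a) * P z * P (b - a - z))"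
    using Pnz by (simp add: \<theta>_def diff_diff_add mult_ac)
  moreover have "P a / P b * (F + \<theta> b / \<theta> a * F' - P b / P a) = - 1 + P (1 - b) / P (1 - a) * F' + P a / P b * F"
    using Pnz by (simp add: \<theta>_def distrib_left right_diff_distrib)
  ultimately have main: "P 1 * P (b - a) * (P (a + z) * P (1 - a - z)) / (P b * P (1 - a) * P z * P (b - a - z))
      = - 1 + P (1 - b) / P (1 - a) * F' + P a / P b * F"
    by simp
  show ?thesis
    unfolding lhs f_term g_term E_def[symmetric] main by (simp only: distrib_right mult_minus1)
qed

end
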